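(* Let $\lambda_1,\lambda_2\in\mathbb{R}$, let $A=\begin{pmatrix}\lambda_1&0\\0&\lambda_2\end{pmatrix}$, and let $T:\mathbb{R}^2\to\mathbb{R}^2$, $Tx=Ax$. Then $T$ is not strongly Devaney chaotic in weak topology. Moreover, if $\lambda_1\neq\lambda_2$ and ($|\lambda_1|=1$ or $|\lambda_2|=1$), then $T$ is weakly Devaney chaotic in weak topology; otherwise, $T$ is not weakly Devaney chaotic in weak topology.
   Context: Let $\mathbb{N}=\{1,2,3,\dots\}$. Continuous linear functionals on $\mathbb{R}^2$ are identified with vectors $x^*\in\mathbb{R}^2$ via $\langle x,x^*\rangle=x_1x_1^*+x_2x_2^*$, and $p_{x^*}(x)=|\langle x,x^*\rangle|$. A point $x$ is periodic for $T$ if $T^kx=x$ for some $k\in\mathbb{N}$. $T$ is weakly (resp. strongly) transitive in weak topology if for some nonzero $x^*$ (resp. every nonzero $x^*$): for all $x,y\in\mathbb{R}^2$ and $\varepsilon>0$ there exist $n\in\mathbb{N}$, $z\in\mathbb{R}^2$ with $p_{x^*}(z-x)<\varepsilon$ and $p_{x^*}(T^nz-y)<\varepsilon$. $T$ has weakly (resp. strongly) dense periodic points in weak topology if for some nonzero $x^*$ (resp. every nonzero $x^*$): for every $x\in\mathbb{R}^2$ and $\varepsilon>0$ there is a periodic point $y$ with $p_{x^*}(x-y)<\varepsilon$. $T$ is strongly sensitive in weak topology if there is $\delta>0$ such that for every nonzero $x^*$, every $x_0\in\mathbb{R}^2$ and every $\varepsilon>0$ there exist $x,y\in\mathbb{R}^2$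 and $n\in\mathbb{N}$ with $p_{x^*}(x-x_0)<\varepsilon$, $p_{x^*}(y-x_0)<\varepsilon$ and $p_{x^*}(T^nx-T^ny)>\delta$. $T$ is weakly sensitive in weak topology if there are $\delta>0$ and a nonzero $x^*$ such that for every $x_0\in\mathbb{R}^2$ and $\varepsilon>0$ there exist such $x,y,n$ (same three inequalities). $T$ is weakly Devaney chaotic in weak topology if it is weakly transitive, has weakly dense periodic points, and is weakly sensitive, all in weak topology (the functionals $x^*$ may differ between the three properties). $T$ is strongly Devaney chaotic in weak topology if it is strongly transitive, has strongly dense periodic points, and is strongly sensitive, all in weak topology. *)

theory Defs
  imports "HOL-Analysis.Analysis"
begin

text \<open>Functionals on the plane are identified with vectors of \<^typ>\<open>real^2\<close> via the inner product;
  iteration counts range over the positive integers.\<close>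

definition weak_seminorm :: "real^2 \<Rightarrow> real^2 \<Rightarrow> real" where
  "weak_seminorm xs x = \<bar>x \<bullet> xs\<bar>"

definition periodic_point :: "(real^2 \<Rightarrow> real^2) \<Rightarrow> real^2 \<Rightarrow> bool" where
  "periodic_point T x \<longleftrightarrow> (\<exists>k\<ge>1. (T ^^ k) x = x)"

definition transitive_wrt :: "(real^2 \<Rightarrow> real^2) \<Rightarrow> real^2 \<Rightarrow> bool" where
  "transitive_wrt T xs \<longleftrightarrow> (\<forall>x y. \<forall>\<epsilon>>0. \<exists>n\<ge>1. \<exists>z.
     weak_seminorm xs (z - x) < \<epsilon> \<and> weak_seminorm xs ((T ^^ n) z - y) < \<epsilon>)"

definition weakly_transitive :: "(real^2 \<Rightarrow> real^2) \<Rightarrow> bool" where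
  "weakly_transitive T \<longleftrightarrow> (\<exists>xs. xs \<noteq> 0 \<and> transitive_wrt T xs)"

definition strongly_transitive :: "(real^2 \<Rightarrow> real^2) \<Rightarrow> bool" where
  "strongly_transitive T \<longleftrightarrow> (\<forall>xs. xs \<noteq> 0 \<longrightarrow> transitive_wrt T xs)"

definition dense_periodic_points_wrt :: "(real^2 \<Rightarrow> real^2) \<Rightarrow> real^2 \<Rightarrow> bool" where
  "dense_periodic_points_wrt T xs \<longleftrightarrow>
     (\<forall>x. \<forall>\<epsilon>>0. \<exists>y. periodic_point T y \<and> weak_seminorm xs (x - y) < \<epsilon>)"

definition weakly_dense_periodic_points :: "(real^2 \<Rightarrow> real^2) \<Rightarrow> bool" where
  "weakly_dense_periodic_points T \<longleftrightarrow> (\<exists>xs. xs \<noteq> 0 \<and> dense_periodic_points_wrt T xs)"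

definition strongly_dense_periodic_points :: "(real^2 \<Rightarrow> real^2) \<Rightarrow> bool" where
  "strongly_dense_periodic_points T \<longleftrightarrow> (\<forall>xs. xs \<noteq> 0 \<longrightarrow> dense_periodic_points_wrt T xs)"

definition sensitive_wrt :: "(real^2 \<Rightarrow> real^2) \<Rightarrow> real \<Rightarrow> real^2 \<Rightarrow> bool" where
  "sensitive_wrt T \<delta> xs \<longleftrightarrow> (\<forall>x0. \<forall>\<epsilon>>0. \<exists>x y. \<exists>n\<ge>1.
     weak_seminorm xs (x - x0) < \<epsilon> \<and> weak_seminorm xs (y - x0) < \<epsilon> \<and>
     weak_seminorm xs ((T ^^ n) x - (T ^^ n) y) > \<delta>)"

definition weakly_sensitive :: "(real^2 \<Rightarrow> real^2) \<Rightarrow> bool" where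
  "weakly_sensitive T \<longleftrightarrow> (\<exists>\<delta>>0. \<exists>xs. xs \<noteq> 0 \<and> sensitive_wrt T \<delta> xs)"

text \<open>The sensitivity constant is uniform in the functional.\<close>

definition strongly_sensitive :: "(real^2 \<Rightarrow> real^2) \<Rightarrow> bool" where
  "strongly_sensitive T \<longleftrightarrow> (\<exists>\<delta>>0. \<forall>xs. xs \<noteq> 0 \<longrightarrow> sensitive_wrt T \<delta> xs)"

definition weakly_Devaney_chaotic :: "(real^2 \<Rightarrow> real^2) \<Rightarrow> bool" where
  "weakly_Devaney_chaotic T \<longleftrightarrow>
     weakly_transitive T \<and> weakly_dense_periodic_points T \<and> weakly_sensitive T"

definition strongly_Devaney_chaotic :: "(real^2 \<Rightarrow> real^2) \<Rightarrow> bool" where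
  "strongly_Devaney_chaotic T \<longleftrightarrow>
     strongly_transitive T \<and> strongly_dense_periodic_points T \<and> strongly_sensitive T"

end

theory Submission
  imports Defs
begin

text \<open>Two opposite situations decide everything.

  If a functional is an eigenvector of the transpose of \<open>T\<close>, with eigenvalue \<open>l\<close>, then it sees \<open>T\<close>
  only as multiplication by \<open>l\<close> on the line. Such a map cannot be chaotic: nonzero periodic values
  force \<open>\<bar>l\<bar> = 1\<close> (\<open>dense_periodic_eigenvalue\<close>), whereas \<open>\<bar>l\<bar> = 1\<close> makes the map an isometry, and an
  isometry is not sensitive (\<open>not_sensitive_isometric_functional\<close>). The coordinate functionals are
  always eigenvectors of a diagonal matrix, which excludes strong chaos. If \<open>l1 = l2\<close>, every
  functional is one, and both facts apply even though density and sensitivity may be witnessed by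
  different functionals. If neither eigenvalue has modulus one, the only periodic point is the
  origin, and every nonzero functional detects that it is not dense.

  If instead a functional \<open>v\<close> and its pullback under \<open>T\<close> are linearly independent, the values of
  \<open>v\<close> at \<open>z\<close> and at \<open>T z\<close> can be prescribed freely. The seminorm controls only the first of them,
  so a single iteration gives transitivity and sensitivity (\<open>transitive_free_image\<close>,
  \<open>sensitive_free_image\<close>). For \<open>v = (1, 1)\<close> this independence
  means exactly \<open>l1 \<noteq> l2\<close>. If in addition some \<open>\<bar>li\<bar> = 1\<close>, then the corresponding axis consists of
  periodic points, and \<open>v\<close> maps it onto the whole line.\<close>

section \<open>Functionals that are eigenvectors of the transpose\<close>

lemma funpow_eigenfunctional:
  fixes T :: "real^2 \<Rightarrow> real^2"
  assumes "\<And>x. T x \<bullet> v = l * (x \<bullet> v)"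
  shows "(T ^^ n) x \<bullet> v = l ^ n * (x \<bullet> v)"
  by (induction n) (simp_all add: assms)

lemma periodic_point_eigenfunctional_zero:
  assumes eig: "\<And>x. T x \<bullet> v = l * (x \<bullet> v)" and "\<bar>l\<bar> \<noteq> 1" and "periodic_point T y"
  shows "y \<bullet> v = 0"
proof -
  obtain k where k: "k \<ge> 1" "(T ^^ k) y = y"
    using \<open>periodic_point T y\<close> unfolding periodic_point_def by blast
  have "l ^ k * (y \<bullet> v) = y \<bullet> v"
    using funpow_eigenfunctional[of T v l k y] eig k(2) by simp
  moreover have "l ^ k \<noteq> 1"
  proof
    assume "l ^ k = 1"
    then have "\<bar>l\<bar> ^ k = 1" by (simp flip: power_abs)
    with k(1) \<open>\<bar>l\<bar> \<noteq> 1\<close> show False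
      using power_eq_imp_eq_base[of "\<bar>l\<bar>" k 1] by simp
  qed
  ultimately show ?thesis by simp
qed

text \<open>The value of \<open>v\<close> at the vector \<open>v\<close> itself is positive, so it cannot be approximated by zeros.\<close>

lemma dense_periodic_not_annihilated:
  assumes "dense_periodic_points_wrt T v" and "v \<noteq> 0"
  obtains y where "periodic_point T y" and "y \<bullet> v \<noteq> 0"
proof -
  have "v \<bullet> v > 0" using \<open>v \<noteq> 0\<close> by simp
  then obtain y where "periodic_point T y" "weak_seminorm v (v - y) < v \<bullet> v"
    using assms(1) unfolding dense_periodic_points_wrt_def by blast
  then show thesis
    using that[of y] by (auto simp: weak_seminorm_def inner_diff_left)
qed

lemma dense_periodic_eigenvalue:
  assumes "\<And>x. T x \<bullet> v = l * (x \<bullet> v)" and "v \<noteq> 0" and "dense_periodic_points_wrt T v"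
  shows "\<bar>l\<bar> = 1"
  using dense_periodic_not_annihilated[OF assms(3,2)]
    periodic_point_eigenfunctional_zero[OF assms(1)] by metis

lemma not_sensitive_isometric_functional:
  assumes eig: "\<And>x. T x \<bullet> v = l * (x \<bullet> v)" and "\<bar>l\<bar> = 1" and "\<delta> > 0"
  shows "\<not> sensitive_wrt T \<delta> v"
proof
  assume "sensitive_wrt T \<delta> v"
  \<comment> \<open>Two points within \<open>\<delta> / 2\<close> of the origin stay within \<open>\<delta>\<close> of each other.\<close>
  moreover have "\<delta> / 2 > 0" using \<open>\<delta> > 0\<close> by simp
  ultimately obtain x y n where
    x: "weak_seminorm v (x - 0) < \<delta> / 2" and y: "weak_seminorm v (y - 0) < \<delta> / 2"
    and xy: "weak_seminorm v ((T ^^ n) x - (T ^^ n) y) > \<delta>"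
    unfolding sensitive_wrt_def by blast
  have "((T ^^ n) x - (T ^^ n) y) \<bullet> v = l ^ n * (x \<bullet> v - y \<bullet> v)"
    using funpow_eigenfunctional[of T v l] eig by (simp add: inner_diff_left right_diff_distrib)
  then have "weak_seminorm v ((T ^^ n) x - (T ^^ n) y) = \<bar>x \<bullet> v - y \<bullet> v\<bar>"
    using \<open>\<bar>l\<bar> = 1\<close> by (simp add: weak_seminorm_def abs_mult power_abs)
  with x y xy show False by (simp add: weak_seminorm_def)
qed

section \<open>Functionals that are independent of their pullback\<close>

lemma transitive_free_image:
  assumes "\<And>a b. \<exists>z. z \<bullet> v = a \<and> T z \<bullet> v = b"
  shows "transitive_wrt T v"
  unfolding transitive_wrt_def
proof (intro allI impI)
  fix x y :: "real^2" and \<epsilon> :: real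
  assume "\<epsilon> > 0"
  obtain z where "z \<bullet> v = x \<bullet> v" "T z \<bullet> v = y \<bullet> v" using assms by blast
  then have "weak_seminorm v (z - x) < \<epsilon> \<and> weak_seminorm v ((T ^^ 1) z - y) < \<epsilon>"
    using \<open>\<epsilon> > 0\<close> by (simp add: weak_seminorm_def inner_diff_left)
  then show "\<exists>n\<ge>1. \<exists>z. weak_seminorm v (z - x) < \<epsilon> \<and> weak_seminorm v ((T ^^ n) z - y) < \<epsilon>"
    by blast
qed

text \<open>Adding to \<open>x0\<close> a vector \<open>w\<close> of seminorm zero is an unnoticed perturbation, yet the image of
  \<open>w\<close> may be as large as desired.\<close>

lemma sensitive_free_image:
  assumes "linear T" and "\<And>a b. \<exists>z. z \<bullet> v = a \<and> T z \<bullet> v = b"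
  shows "sensitive_wrt T \<delta> v"
  unfolding sensitive_wrt_def
proof (intro allI impI)
  fix x0 :: "real^2" and \<epsilon> :: real
  assume "\<epsilon> > 0"
  obtain w where "w \<bullet> v = 0" "T w \<bullet> v = \<bar>\<delta>\<bar> + 1" using assms(2) by blast
  then have "weak_seminorm v ((x0 + w) - x0) < \<epsilon> \<and> weak_seminorm v (x0 - x0) < \<epsilon> \<and>
      weak_seminorm v ((T ^^ 1) (x0 + w) - (T ^^ 1) x0) > \<delta>"
    using \<open>\<epsilon> > 0\<close> \<open>linear T\<close> by (simp add: weak_seminorm_def linear_add)
  then show "\<exists>x y. \<exists>n\<ge>1. weak_seminorm v (x - x0) < \<epsilon> \<and> weak_seminorm v (y - x0) < \<epsilon> \<and>
      weak_seminorm v ((T ^^ n) x - (T ^^ n) y) > \<delta>"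
    by blast
qed

lemma dense_periodic_points_onto:
  assumes "\<And>c. \<exists>y. periodic_point T y \<and> y \<bullet> v = c"
  shows "dense_periodic_points_wrt T v"
  unfolding dense_periodic_points_wrt_def
proof (intro allI impI)
  fix x :: "real^2" and \<epsilon> :: real
  assume "\<epsilon> > 0"
  obtain y where "periodic_point T y" "y \<bullet> v = x \<bullet> v" using assms by blast
  then show "\<exists>y. periodic_point T y \<and> weak_seminorm v (x - y) < \<epsilon>"
    using \<open>\<epsilon> > 0\<close> by (intro exI[of _ y]) (simp add: weak_seminorm_def inner_diff_left)
qed

text \<open>An eigenvalue of modulus one is \<open>1\<close> or \<open>-1\<close>, so two iterations fix its eigenvectors.\<close>

lemma periodic_point_unimodular_eigenvector:
  assumes "linear T" and "T y = l *\<^sub>R y" and "\<bar>l\<bar> = 1"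
  shows "periodic_point T y"
proof -
  have "l * l = 1" using \<open>\<bar>l\<bar> = 1\<close> by (metis abs_mult_self_eq mult_1)
  then have "(T ^^ 2) y = y"
    using assms(1,2) by (simp add: numeral_2_eq_2 linear_scale)
  then show ?thesis
    unfolding periodic_point_def by (intro exI[of _ 2]) simp
qed

section \<open>Diagonal maps\<close>

theorem theorem6p1:
  fixes l1 l2 :: real and A :: "real^2^2" and T :: "real^2 \<Rightarrow> real^2"
  assumes "A = vector [vector [l1, 0], vector [0, l2]]"
    and "T = (\<lambda>x. A *v x)"
  shows "\<not> strongly_Devaney_chaotic T \<and>
    (l1 \<noteq> l2 \<and> (\<bar>l1\<bar> = 1 \<or> \<bar>l2\<bar> = 1) \<longrightarrow> weakly_Devaney_chaotic T) \<and>
    (\<not> (l1 \<noteq> l2 \<and> (\<bar>l1\<bar> = 1 \<or> \<bar>l2\<bar> = 1)) \<longrightarrow> \<not> weakly_Devaney_chaotic T)"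
proof -
  have T1: "T x $ 1 = l1 * x $ 1" and T2: "T x $ 2 = l2 * x $ 2" for x
    by (simp_all add: assms matrix_vector_mult_def sum_2)
  have lin: "linear T" by (simp add: assms(2))
  have inner: "x \<bullet> v = x $ 1 * v $ 1 + x $ 2 * v $ 2" for x v :: "real^2"
    by (simp add: inner_vec_def sum_2)
  have eig1: "T x \<bullet> axis 1 1 = l1 * (x \<bullet> axis 1 1)" and
    eig2: "T x \<bullet> axis 2 1 = l2 * (x \<bullet> axis 2 1)" for x
    by (simp_all add: inner_axis T1 T2)
  have axis1: "axis 1 1 \<noteq> (0 :: real^2)" by (simp add: axis_eq_0_iff)

  have "\<not> strongly_Devaney_chaotic T"
  proof
    assume "strongly_Devaney_chaotic T"
    then obtain \<delta> where "\<delta> > 0" "sensitive_wrt T \<delta> (axis 1 1)"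
      and "dense_periodic_points_wrt T (axis 1 1)"
      using axis1 unfolding strongly_Devaney_chaotic_def strongly_sensitive_def
        strongly_dense_periodic_points_def by blast
    then show False
      using dense_periodic_eigenvalue[OF eig1 axis1] not_sensitive_isometric_functional[OF eig1]
      by blast
  qed
  moreover have "weakly_Devaney_chaotic T" if ne: "l1 \<noteq> l2" and uni: "\<bar>l1\<bar> = 1 \<or> \<bar>l2\<bar> = 1"
  proof -
    define v :: "real^2" where "v = vector [1, 1]"
    have v: "x \<bullet> v = x $ 1 + x $ 2" for x by (simp add: v_def inner)
    have "v \<noteq> 0" by (simp add: v_def vec_eq_iff forall_2)
    have free: "\<exists>z. z \<bullet> v = a \<and> T z \<bullet> v = b" for a b
    proof -
      \<comment> \<open>Cramer's rule for \<open>z1 + z2 = a\<close> and \<open>l1 * z1 + l2 * z2 = b\<close>.\<close>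
      define z :: "real^2" where
        "z = vector [(b - l2 * a) / (l1 - l2), (l1 * a - b) / (l1 - l2)]"
      have "z \<bullet> v = a" "T z \<bullet> v = b"
        using ne by (simp_all add: v T1 T2 z_def divide_simps) (simp_all add: algebra_simps)
      then show ?thesis by blast
    qed
    have "\<exists>y. periodic_point T y \<and> y \<bullet> v = c" for c
      using uni
    proof
      assume "\<bar>l1\<bar> = 1"
      moreover have "T (vector [c, 0]) = l1 *\<^sub>R vector [c, 0]"
        by (simp add: vec_eq_iff forall_2 T1 T2)
      ultimately have "periodic_point T (vector [c, 0])"
        by (intro periodic_point_unimodular_eigenvector[OF lin])
      then show ?thesis by (intro exI[of _ "vector [c, 0]"]) (simp add: v)
    next
      assume "\<bar>l2\<bar> = 1"
      moreover have "T (vector [0, c]) = l2 *\<^sub>R vector [0, c]"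
        by (simp add: vec_eq_iff forall_2 T1 T2)
      ultimately have "periodic_point T (vector [0, c])"
        by (intro periodic_point_unimodular_eigenvector[OF lin])
      then show ?thesis by (intro exI[of _ "vector [0, c]"]) (simp add: v)
    qed
    then have "dense_periodic_points_wrt T v" by (rule dense_periodic_points_onto)
    moreover have "transitive_wrt T v" using free by (rule transitive_free_image)
    moreover have "sensitive_wrt T 1 v" using lin free by (rule sensitive_free_image)
    ultimately show ?thesis
      using \<open>v \<noteq> 0\<close> zero_less_one unfolding weakly_Devaney_chaotic_def weakly_transitive_def
        weakly_dense_periodic_points_def weakly_sensitive_def by blast
  qed
  moreover have "\<not> weakly_Devaney_chaotic T"
    if no: "\<not> (l1 \<noteq> l2 \<and> (\<bar>l1\<bar> = 1 \<or> \<bar>l2\<bar> = 1))"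
  proof
    assume "weakly_Devaney_chaotic T"
    then obtain u w \<delta> where u: "u \<noteq> 0" "dense_periodic_points_wrt T u"
      and w: "\<delta> > 0" "sensitive_wrt T \<delta> w"
      unfolding weakly_Devaney_chaotic_def weakly_dense_periodic_points_def weakly_sensitive_def
      by blast
    show False
    proof (cases "l1 = l2")
      case True
      then have eig: "T x \<bullet> v = l1 * (x \<bullet> v)" for x v
        by (simp add: inner T1 T2 algebra_simps)
      have "\<bar>l1\<bar> = 1" using dense_periodic_eigenvalue[OF eig u] .
      then show False using not_sensitive_isometric_functional[OF eig] w by blast
    next
      case False
      with no have "\<bar>l1\<bar> \<noteq> 1" "\<bar>l2\<bar> \<noteq> 1" by auto
      obtain y where y: "periodic_point T y" "y \<bullet> u \<noteq> 0"
        using dense_periodic_not_annihilated[OF u(2,1)] .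
      have "y \<bullet> axis 1 1 = 0" "y \<bullet> axis 2 1 = 0"
        using periodic_point_eigenfunctional_zero[OF eig1 \<open>\<bar>l1\<bar> \<noteq> 1\<close> y(1)]
          periodic_point_eigenfunctional_zero[OF eig2 \<open>\<bar>l2\<bar> \<noteq> 1\<close> y(1)] by auto
      then have "y $ 1 = 0" "y $ 2 = 0" by (simp_all add: inner_axis)
      then have "y \<bullet> u = 0" by (simp add: inner)
      with y(2) show False by contradiction
    qed
  qed
  ultimately show ?thesis by blast
qed

end
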